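(* The divisive meadow $\mathbb{Q}_0$ of rational numbers admits transformation into simple fractions for closed terms.
   Context: Let $\Sigma$ be the signature with constants $0,1$, binary operators $+$, $\cdot$, $/$ and unary operator $-$. Terms over $\Sigma$ are built as usual from variables; closed terms contain no variables. $\mathbb{Q}_0$ is the algebra over $\Sigma$ with carrier the rational numbers, the usual $0,1,+,\cdot,-$, and total division with $x/0=0$ and $x/y$ the usual quotient if $y\neq 0$. A fraction is a term over $\Sigma$ whose outermost operator is $/$. A simple closed fraction is a closed term that is a fraction of which no proper subterm is a fraction. An algebra $M$ over $\Sigma$ (a divisive meadow) admits transformation into simple fractions for closed terms if, for each closed term $p$ over $\Sigma$, there exists a simple closed fraction $q$ such that $M\models p=q$. *)

theory Defs
  imports Complex_Main
begin

datatype (vars: 'v) trm =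
    Var 'v
  | Zero
  | One
  | Add "'v trm" "'v trm"
  | Mult "'v trm" "'v trm"
  | Frac "'v trm" "'v trm"
  | Neg "'v trm"

definition closed_trm :: "'v trm \<Rightarrow> bool" where
  "closed_trm t \<longleftrightarrow> vars t = {}"

fun subterms :: "'v trm \<Rightarrow> 'v trm set" where
  "subterms (Var x) = {Var x}"
| "subterms Zero = {Zero}"
| "subterms One = {One}"
| "subterms (Add s t) = insert (Add s t) (subterms s \<union> subterms t)"
| "subterms (Mult s t) = insert (Mult s t) (subterms s \<union> subterms t)"
| "subterms (Frac s t) = insert (Frac s t) (subterms s \<union> subterms t)"
| "subterms (Neg t) = insert (Neg t) (subterms t)"

definition proper_subterm :: "'v trm \<Rightarrow> 'v trm \<Rightarrow> bool" where
  "proper_subterm s t \<longleftrightarrow> s \<in> subterms t \<and> s \<noteq> t"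

definition is_fraction :: "'v trm \<Rightarrow> bool" where
  "is_fraction t \<longleftrightarrow> (\<exists>p q. t = Frac p q)"

definition simple_closed_fraction :: "'v trm \<Rightarrow> bool" where
  "simple_closed_fraction t \<longleftrightarrow>
     closed_trm t \<and> is_fraction t \<and> (\<forall>s. proper_subterm s t \<longrightarrow> \<not> is_fraction s)"

text \<open>Algebras over the signature; the carrier is the whole type \<open>'a\<close>.\<close>

record 'a meadow_alg =
  zero_op :: 'a
  one_op :: 'a
  add_op :: "'a \<Rightarrow> 'a \<Rightarrow> 'a"
  mult_op :: "'a \<Rightarrow> 'a \<Rightarrow> 'a"
  div_op :: "'a \<Rightarrow> 'a \<Rightarrow> 'a"
  neg_op :: "'a \<Rightarrow> 'a"

primrec eval_trm :: "'a meadow_alg \<Rightarrow> ('v \<Rightarrow> 'a) \<Rightarrow> 'v trm \<Rightarrow> 'a" where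
  "eval_trm M \<rho> (Var x) = \<rho> x"
| "eval_trm M \<rho> Zero = zero_op M"
| "eval_trm M \<rho> One = one_op M"
| "eval_trm M \<rho> (Add s t) = add_op M (eval_trm M \<rho> s) (eval_trm M \<rho> t)"
| "eval_trm M \<rho> (Mult s t) = mult_op M (eval_trm M \<rho> s) (eval_trm M \<rho> t)"
| "eval_trm M \<rho> (Frac s t) = div_op M (eval_trm M \<rho> s) (eval_trm M \<rho> t)"
| "eval_trm M \<rho> (Neg t) = neg_op M (eval_trm M \<rho> t)"

definition satisfies_eq :: "'a meadow_alg \<Rightarrow> 'v trm \<Rightarrow> 'v trm \<Rightarrow> bool" where
  "satisfies_eq M p q \<longleftrightarrow> (\<forall>\<rho>. eval_trm M \<rho> p = eval_trm M \<rho> q)"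

text \<open>Variables are drawn from the countably infinite supply \<^typ>\<open>nat\<close>.\<close>

definition admits_simple_fractions_closed :: "'a meadow_alg \<Rightarrow> bool" where
  "admits_simple_fractions_closed M \<longleftrightarrow>
     (\<forall>p :: nat trm. closed_trm p \<longrightarrow>
        (\<exists>q :: nat trm. simple_closed_fraction q \<and> satisfies_eq M p q))"

text \<open>Division on \<^typ>\<open>rat\<close> is already total with \<open>x / 0 = 0\<close>.\<close>

definition Q0 :: "rat meadow_alg" where
  "Q0 = \<lparr>zero_op = 0, one_op = 1, add_op = (+), mult_op = (*), div_op = (/), neg_op = uminus\<rparr>"

end

theory Submission
  imports Defs
begin

text \<open>A closed term has the same value under every valuation, and that value is a rational
  number, hence a quotient of two integers. Integers are denoted by division-free closed terms.\<close>

primrec nat_trm :: "nat \<Rightarrow> 'v trm" where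
  "nat_trm 0 = Zero"
| "nat_trm (Suc n) = Add (nat_trm n) One"

definition int_trm :: "int \<Rightarrow> 'v trm" where
  "int_trm k = (if 0 \<le> k then nat_trm (nat k) else Neg (nat_trm (nat (- k))))"

lemma vars_nat_trm: "vars (nat_trm n) = {}"
  by (induction n) auto

lemma vars_int_trm: "vars (int_trm k) = {}"
  by (simp add: int_trm_def vars_nat_trm)

text \<open>The numeral itself is included among the subterms because, as an argument of
  \<open>Frac\<close>, it becomes a proper subterm.\<close>

lemma not_is_fraction_subterm_nat_trm: "s \<in> subterms (nat_trm n) \<Longrightarrow> \<not> is_fraction s"
  by (induction n) (auto simp: is_fraction_def)

lemma not_is_fraction_subterm_int_trm: "s \<in> subterms (int_trm k) \<Longrightarrow> \<not> is_fraction s"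
  using not_is_fraction_subterm_nat_trm
  by (auto simp: int_trm_def is_fraction_def split: if_splits)

lemma eval_nat_trm: "eval_trm Q0 \<rho> (nat_trm n) = of_nat n"
  by (induction n) (simp_all add: Q0_def)

lemma eval_int_trm: "eval_trm Q0 \<rho> (int_trm k) = of_int k"
proof (cases "0 \<le> k")
  case True
  then show ?thesis by (simp add: int_trm_def eval_nat_trm)
next
  case False
  then have "eval_trm Q0 \<rho> (int_trm k) = - of_nat (nat (- k))"
    \<comment> \<open>\<open>Q0\<close> stays folded until \<open>eval_nat_trm\<close> has rewritten
      the numeral; only then is \<open>neg_op\<close> computed.\<close>
    by (simp add: int_trm_def eval_nat_trm) (simp add: Q0_def)
  also have "\<dots> = of_int k"
    using False by simp
  finally show ?thesis .
qed

text \<open>A proper subterm of a \<open>Frac\<close> lies within one of its two arguments, and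
  these are free of division.\<close>

lemma simple_closed_fraction_int_trms: "simple_closed_fraction (Frac (int_trm a) (int_trm b))"
  using not_is_fraction_subterm_int_trm
  by (fastforce simp: simple_closed_fraction_def closed_trm_def vars_int_trm is_fraction_def
      proper_subterm_def)

text \<open>The valuation enters evaluation only at variables.\<close>

lemma eval_trm_closed:
  assumes "closed_trm p"
  shows "eval_trm M \<rho> p = eval_trm M \<sigma> p"
  using assms by (induction p) (auto simp: closed_trm_def)

theorem theorem16:
  shows "admits_simple_fractions_closed Q0"
  unfolding admits_simple_fractions_closed_def
proof (intro allI impI)
  fix p :: "nat trm"
  assume p: "closed_trm p"
  \<comment> \<open>The zero valuation is an arbitrary choice. Writing the value as
    \<open>Fract a b\<close> supplies the numerator and denominator at once, so no induction on
    \<open>p\<close> is needed to combine fractions.\<close>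
  obtain a b where ab: "eval_trm Q0 (\<lambda>_. 0) p = of_int a / of_int b"
    by (cases "eval_trm Q0 (\<lambda>_. 0) p") (auto simp: Fract_of_int_quotient)
  have "eval_trm Q0 \<rho> (Frac (int_trm a) (int_trm b)) = of_int a / of_int b" for \<rho> :: "nat \<Rightarrow> rat"
    by (simp add: eval_int_trm) (simp add: Q0_def)
  then have "satisfies_eq Q0 p (Frac (int_trm a) (int_trm b))"
    \<comment> \<open>\<open>eval_trm_closed\<close> carries \<open>ab\<close> from the zero
      valuation to every other one.\<close>
    unfolding satisfies_eq_def using ab eval_trm_closed[OF p] by metis
  with simple_closed_fraction_int_trms
  show "\<exists>q. simple_closed_fraction q \<and> satisfies_eq Q0 p q"
    by blast
qed

end
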